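(* Let $n,k$ be integers with $0<k<n$. Every $W\in\mathcal{K}^*$ admits a unique representation of the form $$W=\begin{bmatrix}k\alpha&z^\top \\ z&\operatorname{Diag}(d)\end{bmatrix},$$ where $\alpha\in\mathbb{R}$, $z,d\in\mathbb{R}^n$ satisfy $\alpha\ge0$, $d\ge0$ (entrywise), and $z_i^2\le\alpha d_i$ for all $i\in\{1,\dots,n\}$.
   Context: $\mathbb{S}^{n+1}$ is the space of real symmetric $(n+1)\times(n+1)$ matrices with $\langle U,V\rangle=\mathrm{Tr}(UV^\top)$. Matrices are partitioned as $Y=\begin{bmatrix}Y_{11}&Y_{12} \\ Y_{21}&Y_{22}\end{bmatrix}$ with $Y_{11}\in\mathbb{R}$, $Y_{22}\in\mathbb{S}^n$. $\operatorname{Diag}(d)$ for a vector $d$ is the diagonal matrix with diagonal $d$; $\operatorname{Diag}(M)$ for a square matrix $M$ is the diagonal matrix with the same diagonal as $M$. The sparsity cone is $$\mathcal{K}=\left\{Y\in\mathbb{S}^{n+1}:\begin{bmatrix}kY_{11}&Y_{12} \\ Y_{21}&\operatorname{Diag}(Y_{22})\end{bmatrix}\succeq0\right\},$$ and its dual cone is $\mathcal{K}^*=\{W\in\mathbb{S}^{n+1}:\langle W,Y\rangle\ge0\ \ \forall\,Y\in\mathcal{K}\}$. *)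

theory Defs
  imports Complex_Main "Jordan_Normal_Form.Matrix"
begin

definition sym_mats :: "nat \<Rightarrow> real mat set" where
  "sym_mats m = {A \<in> carrier_mat m m. transpose_mat A = A}"

definition trace :: "real mat \<Rightarrow> real" where
  "trace A = (\<Sum>i<dim_row A. A $$ (i, i))"

definition mat_inner :: "real mat \<Rightarrow> real mat \<Rightarrow> real" where
  "mat_inner U V = trace (U * transpose_mat V)"

definition psd :: "real mat \<Rightarrow> bool" where
  "psd A \<longleftrightarrow> A \<in> sym_mats (dim_row A) \<and>
     (\<forall>v \<in> carrier_vec (dim_row A). 0 \<le> v \<bullet> (A *\<^sub>v v))"

definition Diag_vec :: "real vec \<Rightarrow> real mat" where
  "Diag_vec d = mat_diag (dim_vec d) (\<lambda>i. d $ i)"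

definition Diag_mat :: "real mat \<Rightarrow> real mat" where
  "Diag_mat M = mat_diag (dim_row M) (\<lambda>i. M $$ (i, i))"

(* split_block Y 1 1 cuts off the first row and column, so Y11 is a 1 x 1 matrix,
   Y12 is 1 x n, Y21 is n x 1 and Y22 is n x n. *)
definition sparsity_cone :: "nat \<Rightarrow> nat \<Rightarrow> real mat set" where
  "sparsity_cone n k = {Y \<in> sym_mats (n + 1).
     (case split_block Y 1 1 of (Y11, Y12, Y21, Y22) \<Rightarrow>
        psd (four_block_mat (real k \<cdot>\<^sub>m Y11) Y12 Y21 (Diag_mat Y22)))}"

definition dual_cone :: "nat \<Rightarrow> real mat set \<Rightarrow> real mat set" where
  "dual_cone m C = {W \<in> sym_mats m. \<forall>Y \<in> C. 0 \<le> mat_inner W Y}"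

end

theory Submission
  imports Defs
begin

text \<open>
  Testing \<open>W\<close> against symmetric matrices supported on two indices suffices. Off-diagonal entries of
  the lower right block are unconstrained in the cone, so the corresponding entries of \<open>W\<close> vanish.
  Testing against the matrices whose arrow matrix is the rank-one matrix of \<open>a e\<^sub>0 + b e\<^sub>i\<close> shows
  that the binary form \<open>\<alpha> a\<^sup>2 + 2 z\<^sub>i a b + d\<^sub>i b\<^sup>2\<close> is nonnegative, which is the discriminant condition.
\<close>

lemma mat_inner_eq_sum:
  assumes "U \<in> carrier_mat m n" and "V \<in> carrier_mat m n"
  shows "mat_inner U V = (\<Sum>i<m. \<Sum>j<n. U $$ (i, j) * V $$ (i, j))"
  using assms by (auto simp: mat_inner_def trace_def scalar_prod_def atLeast0LessThan
      intro!: sum.cong)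

lemma sym_mats_index:
  assumes "A \<in> sym_mats m" and "i < m" and "j < m"
  shows "A $$ (i, j) = A $$ (j, i)"
proof -
  have "transpose_mat A $$ (i, j) = A $$ (j, i)"
    using assms by (intro index_transpose_mat) (auto simp: sym_mats_def)
  with assms show ?thesis by (simp add: sym_mats_def)
qed

text \<open>The quadratic form at \<open>v\<close> is the square of the inner product of
  \<open>u\<close> and \<open>v\<close>.\<close>

lemma psd_rank_one: "psd (mat m m (\<lambda>(i, j). u i * u j))"
proof -
  let ?A = "mat m m (\<lambda>(i, j). u i * u j)"
  have "0 \<le> v \<bullet> (?A *\<^sub>v v)" if v: "v \<in> carrier_vec m" for v
  proof -
    have "v \<bullet> (?A *\<^sub>v v) = (\<Sum>i<m. v $ i * (\<Sum>j<m. u i * u j * v $ j))"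
      using v by (auto simp: scalar_prod_def atLeast0LessThan intro!: sum.cong)
    also have "\<dots> = (\<Sum>i<m. u i * v $ i)\<^sup>2"
      by (simp add: power2_eq_square sum_product sum_distrib_left mult_ac)
    finally show ?thesis by simp
  qed
  moreover have "transpose_mat ?A = ?A" by (auto simp: mult_ac)
  ultimately show ?thesis by (simp add: psd_def sym_mats_def)
qed

text \<open>The hypotheses say entry by entry that the arrow matrix of \<open>Y\<close> is the outer
  product of \<open>u\<close> with itself, which is positive semidefinite. Since that matrix has a
  diagonal lower right block, \<open>off_diag\<close> lets at most one of the
  \<open>u (Suc i)\<close> be nonzero. The off-diagonal entries of \<open>Y\<close> in this block
  remain free.\<close>

lemma sparsity_cone_rank_oneI:
  assumes Y: "Y \<in> sym_mats (n + 1)"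
    and corner: "real k * Y $$ (0, 0) = (u 0)\<^sup>2"
    and border: "\<And>i. i < n \<Longrightarrow> Y $$ (0, Suc i) = u 0 * u (Suc i)"
    and diag: "\<And>i. i < n \<Longrightarrow> Y $$ (Suc i, Suc i) = (u (Suc i))\<^sup>2"
    and off_diag: "\<And>i j. i < n \<Longrightarrow> j < n \<Longrightarrow> i \<noteq> j \<Longrightarrow> u (Suc i) * u (Suc j) = 0"
  shows "Y \<in> sparsity_cone n k"
proof -
  obtain Y11 Y12 Y21 Y22 where split: "split_block Y 1 1 = (Y11, Y12, Y21, Y22)"
    by (metis prod_cases4)
  have dims: "dim_row Y = n + 1" "dim_col Y = n + 1"
    using Y by (auto simp: sym_mats_def)
  have border': "Y $$ (Suc i, 0) = u 0 * u (Suc i)" if "i < n" for i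
    using sym_mats_index[OF Y, of "Suc i" 0] border that by simp
  have "four_block_mat (real k \<cdot>\<^sub>m Y11) Y12 Y21 (Diag_mat Y22)
      = mat (n + 1) (n + 1) (\<lambda>(i, j). u i * u j)" (is "?A = ?B")
  proof (rule eq_matI)
    fix i j assume "i < dim_row ?B" "j < dim_col ?B"
    then show "?A $$ (i, j) = ?B $$ (i, j)"
      using split dims corner border border' diag off_diag
      by (cases i; cases j)
        (auto simp: split_block_def Let_def four_block_mat_def Diag_mat_def mat_diag_def
          power2_eq_square mult_ac)
  qed (use split dims in \<open>auto simp: split_block_def Let_def four_block_mat_def Diag_mat_def
      mat_diag_def\<close>)
  then show ?thesis
    using Y split psd_rank_one by (simp add: sparsity_cone_def)
qed

text \<open>For distinct \<open>p\<close> and \<open>q\<close> this embeds the symmetric 2 x 2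
  matrix with rows (x, y) and (y, w) as a principal submatrix, so that pairing with it sees only the
  entries of \<open>W\<close> at these two indices.\<close>

definition two_point_mat :: "nat \<Rightarrow> nat \<Rightarrow> nat \<Rightarrow> real \<Rightarrow> real \<Rightarrow> real \<Rightarrow> real mat" where
  "two_point_mat m p q x y w = mat m m (\<lambda>(i, j).
     if i = p \<and> j = p then x else if i = q \<and> j = q then w
     else if i = p \<and> j = q \<or> i = q \<and> j = p then y else 0)"

lemma two_point_mat_index:
  assumes "i < m" and "j < m"
  shows "two_point_mat m p q x y w $$ (i, j) =
    (if i = p \<and> j = p then x else if i = q \<and> j = q then w
     else if i = p \<and> j = q \<or> i = q \<and> j = p then y else 0)"
  using assms by (simp add: two_point_mat_def)

lemma two_point_mat_sym: "two_point_mat m p q x y w \<in> sym_mats m"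
proof -
  have "transpose_mat (two_point_mat m p q x y w) = two_point_mat m p q x y w"
    (is "transpose_mat ?Y = _")
  proof (rule eq_matI)
    fix i j assume "i < dim_row ?Y" "j < dim_col ?Y"
    then have "i < m" "j < m" by (simp_all add: two_point_mat_def)
    moreover from this have "transpose_mat ?Y $$ (i, j) = ?Y $$ (j, i)"
      by (intro index_transpose_mat) (simp_all add: two_point_mat_def)
    ultimately show "transpose_mat ?Y $$ (i, j) = ?Y $$ (i, j)"
      by (simp only: two_point_mat_index) argo
  qed (simp_all add: two_point_mat_def)
  then show ?thesis by (simp add: sym_mats_def two_point_mat_def)
qed

lemma mat_inner_two_point:
  assumes W: "W \<in> sym_mats m" and pq: "p < m" "q < m" "p \<noteq> q"
  shows "mat_inner W (two_point_mat m p q x y w) =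
    W $$ (p, p) * x + 2 * W $$ (p, q) * y + W $$ (q, q) * w"
proof -
  let ?Y = "two_point_mat m p q x y w"
  have "mat_inner W ?Y = (\<Sum>i<m. \<Sum>j<m. W $$ (i, j) * ?Y $$ (i, j))"
    using W two_point_mat_sym by (intro mat_inner_eq_sum) (auto simp: sym_mats_def)
  also have "\<dots> = (\<Sum>i\<in>{p, q}. \<Sum>j<m. W $$ (i, j) * ?Y $$ (i, j))"
    using pq by (intro sum.mono_neutral_right) (auto simp: two_point_mat_index)
  also have "\<dots> = (\<Sum>i\<in>{p, q}. \<Sum>j\<in>{p, q}. W $$ (i, j) * ?Y $$ (i, j))"
    using pq by (intro sum.cong refl sum.mono_neutral_right) (auto simp: two_point_mat_index)
  also have "\<dots> = W $$ (p, p) * x + 2 * W $$ (p, q) * y + W $$ (q, q) * w"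
    using pq sym_mats_index[OF W, of q p] by (simp add: two_point_mat_index)
  finally show ?thesis .
qed

lemma discriminant_nonneg_form:
  fixes \<alpha> z d :: real
  assumes form: "\<And>a b. 0 \<le> \<alpha> * a\<^sup>2 + 2 * z * (a * b) + d * b\<^sup>2"
  shows "0 \<le> \<alpha>" and "0 \<le> d" and "z\<^sup>2 \<le> \<alpha> * d"
proof -
  show \<alpha>: "0 \<le> \<alpha>" and "0 \<le> d" using form[of 1 0] form[of 0 1] by simp_all
  show "z\<^sup>2 \<le> \<alpha> * d"
  proof (cases "\<alpha> = 0")
    case True
    have "z = 0"
    proof (rule ccontr)
      assume "z \<noteq> 0"
      \<comment> \<open>With vanishing leading coefficient the form at b = 1 is affine in a; this a
        makes its value -1.\<close>
      then show False using form[of "- (d + 1) / (2 * z)" 1] True by simp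
    qed
    then show ?thesis using True by simp
  next
    case False
    \<comment> \<open>For b = 1 the form is minimal at a = -z / \<alpha>; scaling that point by
      \<alpha> avoids the division.\<close>
    have "0 \<le> \<alpha> * (\<alpha> * d - z\<^sup>2)"
      using form[of "- z" \<alpha>] by (simp add: power2_eq_square algebra_simps)
    then show ?thesis using False \<alpha> by (simp add: zero_le_mult_iff)
  qed
qed

lemma dual_sparsity_cone_off_diag:
  assumes W: "W \<in> dual_cone (n + 1) (sparsity_cone n k)"
    and ij: "i < n" "j < n" "i \<noteq> j"
  shows "W $$ (Suc i, Suc j) = 0"
proof -
  let ?Y = "two_point_mat (n + 1) (Suc i) (Suc j) 0"
  have "0 \<le> 2 * W $$ (Suc i, Suc j) * c" for c
  proof -
    \<comment> \<open>The entry \<open>c\<close> lies off the diagonal of the lower right block, so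
      the arrow matrix is zero whatever the sign of \<open>c\<close>.\<close>
    have "?Y c 0 \<in> sparsity_cone n k"
      using ij two_point_mat_sym
      by (intro sparsity_cone_rank_oneI[where u = "\<lambda>_. 0"]) (auto simp: two_point_mat_index)
    then have "0 \<le> mat_inner W (?Y c 0)" using W by (simp add: dual_cone_def)
    then show ?thesis
      using W ij mat_inner_two_point[of W "n + 1" "Suc i" "Suc j"] by (simp add: dual_cone_def)
  qed
  from this[of 1] this[of "- 1"] show ?thesis by simp
qed

lemma dual_sparsity_cone_form_nonneg:
  assumes W: "W \<in> dual_cone (n + 1) (sparsity_cone n k)" and k: "0 < k" and i: "i < n"
  shows "0 \<le> W $$ (0, 0) / real k * a\<^sup>2 + 2 * W $$ (0, Suc i) * (a * b)
    + W $$ (Suc i, Suc i) * b\<^sup>2"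
proof -
  \<comment> \<open>The cone condition multiplies the corner by \<open>k\<close>, so the corner must
    be divided by \<open>k\<close> to give a square. This is where the leading coefficient
    \<open>W $$ (0, 0) / real k\<close> comes from.\<close>
  let ?Y = "two_point_mat (n + 1) 0 (Suc i) (a\<^sup>2 / real k) (a * b) (b\<^sup>2)"
  let ?u = "\<lambda>r. if r = 0 then a else if r = Suc i then b else 0"
  have "?Y \<in> sparsity_cone n k"
    using i k two_point_mat_sym
    by (intro sparsity_cone_rank_oneI[where u = ?u]) (auto simp: two_point_mat_index)
  then have "0 \<le> mat_inner W ?Y" using W by (simp add: dual_cone_def)
  then show ?thesis
    using W i mat_inner_two_point[of W "n + 1" 0 "Suc i"] by (simp add: dual_cone_def)
qed

text \<open>Symmetry of \<open>W\<close> settles the first column once the first row is known. Read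
  from right to left this gives existence of the representation, from left to right its
  uniqueness.\<close>

lemma bordered_diag_eq_iff:
  assumes W: "W \<in> sym_mats (n + 1)" and z: "z \<in> carrier_vec n" and d: "d \<in> carrier_vec n"
  shows "W = four_block_mat (mat 1 1 (\<lambda>_. c)) (mat_of_rows n [z]) (mat_of_cols n [z]) (Diag_vec d)
    \<longleftrightarrow> W $$ (0, 0) = c \<and> (\<forall>i<n. W $$ (0, Suc i) = z $ i)
      \<and> (\<forall>i<n. \<forall>j<n. W $$ (Suc i, Suc j) = (if i = j then d $ i else 0))"
    (is "W = ?B \<longleftrightarrow> ?R")
proof -
  have dims: "dim_row W = n + 1" "dim_col W = n + 1"
    using W by (auto simp: sym_mats_def)
  have B: "?B $$ (0, 0) = c" "\<And>i. i < n \<Longrightarrow> ?B $$ (0, Suc i) = z $ i"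
    "\<And>i. i < n \<Longrightarrow> ?B $$ (Suc i, 0) = z $ i"
    "\<And>i j. i < n \<Longrightarrow> j < n \<Longrightarrow> ?B $$ (Suc i, Suc j) = (if i = j then d $ i else 0)"
    using z d
    by (auto simp: four_block_mat_def Diag_vec_def mat_diag_def mat_of_rows_def mat_of_cols_def)
  show ?thesis
  proof
    assume "W = ?B"
    then show ?R using B by (metis (no_types, lifting))
  next
    assume R: ?R
    show "W = ?B"
    proof (rule eq_matI)
      fix i j assume "i < dim_row ?B" "j < dim_col ?B"
      then have "i < n + 1" "j < n + 1" using d by (simp_all add: Diag_vec_def mat_diag_def)
      then show "W $$ (i, j) = ?B $$ (i, j)"
        using R B sym_mats_index[OF W, of i 0] by (cases i; cases j) (auto simp del: index_mat_four_block)
    qed (use d dims in \<open>auto simp: Diag_vec_def mat_diag_def\<close>)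
  qed
qed

theorem proposition3:
  fixes n k :: nat and W :: "real mat"
  assumes "0 < k" and "k < n"
    and "W \<in> dual_cone (n + 1) (sparsity_cone n k)"
  shows "\<exists>!(\<alpha> :: real, z :: real vec, d :: real vec).
    z \<in> carrier_vec n \<and> d \<in> carrier_vec n \<and>
    0 \<le> \<alpha> \<and> 0\<^sub>v n \<le> d \<and>
    (\<forall>i<n. (z $ i)\<^sup>2 \<le> \<alpha> * d $ i) \<and>
    W = four_block_mat
          (mat 1 1 (\<lambda>_. real k * \<alpha>)) (mat_of_rows n [z])
          (mat_of_cols n [z])          (Diag_vec d)"
    (is "\<exists>!p. ?P p")
proof -
  define \<alpha> where "\<alpha> = W $$ (0, 0) / real k"
  define z where "z = vec n (\<lambda>i. W $$ (0, Suc i))"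
  define d where "d = vec n (\<lambda>i. W $$ (Suc i, Suc i))"
  have W: "W \<in> sym_mats (n + 1)" using assms(3) by (simp add: dual_cone_def)
  have form: "0 \<le> \<alpha> * a\<^sup>2 + 2 * z $ i * (a * b) + d $ i * b\<^sup>2" if "i < n" for i a b
    using dual_sparsity_cone_form_nonneg[OF assms(3,1) that] that
    by (simp add: \<alpha>_def z_def d_def)
  \<comment> \<open>The form is available only for an index below \<open>n\<close>; such an index
    exists because \<open>k < n\<close> makes \<open>n\<close> positive.\<close>
  have "0 \<le> \<alpha>" using discriminant_nonneg_form(1)[OF form] assms(2) by blast
  moreover have "0\<^sub>v n \<le> d"
    using discriminant_nonneg_form(2)[OF form] by (auto simp: less_eq_vec_def d_def)
  moreover have "\<forall>i<n. (z $ i)\<^sup>2 \<le> \<alpha> * d $ i"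
    using discriminant_nonneg_form(3)[OF form] by blast
  moreover have "W = four_block_mat (mat 1 1 (\<lambda>_. real k * \<alpha>)) (mat_of_rows n [z])
      (mat_of_cols n [z]) (Diag_vec d)"
    using assms(1) dual_sparsity_cone_off_diag[OF assms(3)]
    by (subst bordered_diag_eq_iff[OF W]) (auto simp: \<alpha>_def z_def d_def)
  moreover have "z \<in> carrier_vec n" "d \<in> carrier_vec n" by (simp_all add: z_def d_def)
  ultimately have "?P (\<alpha>, z, d)" by (simp only: prod.case simp_thms)
  moreover have "p = (\<alpha>, z, d)" if "?P p" for p
  proof -
    obtain \<alpha>' z' d' where p: "p = (\<alpha>', z', d')" by (rule prod_cases3)
    from that have z'd': "z' \<in> carrier_vec n" "d' \<in> carrier_vec n"
      and eq: "W = four_block_mat (mat 1 1 (\<lambda>_. real k * \<alpha>')) (mat_of_rows n [z'])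
        (mat_of_cols n [z']) (Diag_vec d')"
      by (simp_all only: p prod.case)
    \<comment> \<open>Comparing entries recovers \<open>z'\<close> and \<open>d'\<close> from
      \<open>W\<close>, and \<alpha>' from the corner after cancelling the positive
      \<open>k\<close>.\<close>
    from eq[unfolded bordered_diag_eq_iff[OF W z'd']]
    have "W $$ (0, 0) = real k * \<alpha>'" and z': "\<And>i. i < n \<Longrightarrow> W $$ (0, Suc i) = z' $ i"
      and d': "\<And>i. i < n \<Longrightarrow> W $$ (Suc i, Suc i) = d' $ i"
      by simp_all
    moreover have "z' = z" using z'd' z' by (intro eq_vecI) (simp_all add: z_def)
    moreover have "d' = d" using z'd' d' by (intro eq_vecI) (simp_all add: d_def)
    ultimately show ?thesis using assms(1) by (simp add: p \<alpha>_def)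
  qed
  ultimately show ?thesis by (rule ex1I)
qed

end
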